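(* Let $p>3$ be a prime and let $G$ be an abelian group of order dividing $p^5$. Then \[ \nabla(G)\cong \begin{cases} \mathbb{Z}_{p^5} & \text{if } G\cong G_1,\\ \mathbb{Z}_{p^3}\oplus\mathbb{Z}_{p^2}^{(2)} & \text{if } G\cong G_{13},\\ \mathbb{Z}_{p^4}\oplus\mathbb{Z}_{p}^{(2)} & \text{if } G\cong G_{26},\\ \mathbb{Z}_{p^2}^{(3)}\oplus\mathbb{Z}_{p}^{(3)} & \text{if } G\cong G_{43},\\ \mathbb{Z}_{p^3}\oplus\mathbb{Z}_{p}^{(5)} & \text{if } G\cong G_{51},\\ \mathbb{Z}_{p^2}\oplus\mathbb{Z}_{p}^{(9)} & \text{if } G\cong G_{66},\\ \mathbb{Z}_{p}^{(15)} & \text{if } G\cong G_{70}. \end{cases} \]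
   Context: Notation: $\mathbb{Z}_n$ is the cyclic group of order $n$, and $A^{(n)}$ is the direct sum of $n$ copies of $A$. The groups are $G_1\cong\mathbb{Z}_{p^5}$, $G_{13}\cong\mathbb{Z}_{p^3}\times\mathbb{Z}_{p^2}$, $G_{26}\cong\mathbb{Z}_{p^4}\times\mathbb{Z}_p$, $G_{43}\cong\mathbb{Z}_{p^2}\times\mathbb{Z}_{p^2}\times\mathbb{Z}_p$, $G_{51}\cong\mathbb{Z}_{p^3}\times\mathbb{Z}_p\times\mathbb{Z}_p$, $G_{66}\cong\mathbb{Z}_{p^2}\times\mathbb{Z}_p\times\mathbb{Z}_p\times\mathbb{Z}_p$, $G_{70}\cong\mathbb{Z}_p^{(5)}$. For a group $G$ write ${}^{g}g'=gg'g^{-1}$. The non-abelian tensor square $G\otimes G$ is the group generated by symbols $g\otimes h$ ($g,h\in G$) subject to $gg'\otimes h=({}^{g}g'\otimes{}^{g}h)(g\otimes h)$ and $g\otimes hh'=(g\otimes h)({}^{h}g\otimes{}^{h}h')$ for all $g,g',h,h'\in G$. $\nabla(G)$ is the subgroup of $G\otimes G$ generated by all $g\otimes g$, $g\in G$. *)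

theory Defs
  imports "HOL-Algebra.Product_Groups" "HOL-Computational_Algebra.Primes"
begin

text \<open>
  A word is a list of letters; the letter \<open>(True, x)\<close> stands for the generator \<open>x\<close> and
  \<open>(False, x)\<close> for its formal inverse. A pair \<open>(u, v)\<close> of words in a set of relations stands
  for the relation \<open>u = v\<close>.
\<close>

type_synonym 'x gword = "(bool \<times> 'x) list"

definition gwords :: "'x set \<Rightarrow> 'x gword set"
  where "gwords X = lists (UNIV \<times> X)"

inductive pres_eq :: "'x set \<Rightarrow> ('x gword \<times> 'x gword) set \<Rightarrow> 'x gword \<Rightarrow> 'x gword \<Rightarrow> bool"
  for X R
where
  refl: "u \<in> gwords X \<Longrightarrow> pres_eq X R u u"
| sym: "pres_eq X R u v \<Longrightarrow> pres_eq X R v u"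
| trans: "pres_eq X R u v \<Longrightarrow> pres_eq X R v w \<Longrightarrow> pres_eq X R u w"
| append: "pres_eq X R u u' \<Longrightarrow> pres_eq X R v v' \<Longrightarrow> pres_eq X R (u @ v) (u' @ v')"
| cancel: "x \<in> X \<Longrightarrow> pres_eq X R [(b, x), (\<not> b, x)] []"
| rel: "(u, v) \<in> R \<Longrightarrow> u \<in> gwords X \<Longrightarrow> v \<in> gwords X \<Longrightarrow> pres_eq X R u v"

definition pres_class :: "'x set \<Rightarrow> ('x gword \<times> 'x gword) set \<Rightarrow> 'x gword \<Rightarrow> 'x gword set"
  where "pres_class X R u = {v. pres_eq X R u v}"

definition presented_group :: "'x set \<Rightarrow> ('x gword \<times> 'x gword) set \<Rightarrow> 'x gword set monoid"
  where "presented_group X R =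
    \<lparr>carrier = pres_class X R ` gwords X,
     monoid.mult = (\<lambda>A B. \<Union>u\<in>A. \<Union>v\<in>B. pres_class X R (u @ v)),
     one = pres_class X R []\<rparr>"

lemma pres_eq_gwords: "pres_eq X R u v \<Longrightarrow> u \<in> gwords X \<and> v \<in> gwords X"
  by (induction rule: pres_eq.induct) (auto simp: gwords_def)

lemma pres_class_eq_iff:
  "u \<in> gwords X \<Longrightarrow> pres_class X R u = pres_class X R v \<longleftrightarrow> pres_eq X R u v"
  unfolding pres_class_def by (blast intro: pres_eq.refl pres_eq.sym pres_eq.trans)

lemma presented_group_mult:
  assumes "u \<in> gwords X" "v \<in> gwords X"
  shows "pres_class X R u \<otimes>\<^bsub>presented_group X R\<^esub> pres_class X R v = pres_class X R (u @ v)"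
  using assms unfolding presented_group_def pres_class_def
  by simp (blast intro: pres_eq.refl pres_eq.sym pres_eq.trans pres_eq.append)

lemma gwords_inverse:
  assumes "u \<in> gwords X"
  shows "\<exists>v\<in>gwords X. pres_eq X R (v @ u) []"
  using assms
proof (induction u)
  case Nil
  then show ?case by (intro bexI[of _ "[]"]) (auto simp: gwords_def intro: pres_eq.refl)
next
  case (Cons a u)
  obtain b x where a: "a = (b, x)" by (cases a)
  have x: "x \<in> X" and u: "u \<in> gwords X" using Cons.prems by (auto simp: gwords_def a)
  obtain v where v: "v \<in> gwords X" "pres_eq X R (v @ u) []" using Cons.IH u by blast
  have "pres_eq X R [(\<not> b, x), (b, x)] []" using pres_eq.cancel[OF x, of R "\<not> b"] by simp
  then have "pres_eq X R (v @ [(\<not> b, x), (b, x)] @ u) (v @ [] @ u)"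
    by (intro pres_eq.append pres_eq.refl v u)
  then have "pres_eq X R ((v @ [(\<not> b, x)]) @ a # u) []"
    using v(2) by (auto simp: a intro: pres_eq.trans)
  moreover have "v @ [(\<not> b, x)] \<in> gwords X" using v x by (auto simp: gwords_def)
  ultimately show ?case by blast
qed

lemma group_presented_group: "group (presented_group X R)"
proof (rule groupI)
  have c: "carrier (presented_group X R) = pres_class X R ` gwords X"
    and o: "\<one>\<^bsub>presented_group X R\<^esub> = pres_class X R []"
    by (simp_all add: presented_group_def)
  have app: "u @ v \<in> gwords X" if "u \<in> gwords X" "v \<in> gwords X" for u v :: "'a gword"
    using that by (auto simp: gwords_def)
  have nil: "[] \<in> gwords X" by (simp add: gwords_def)
  note [simp] = c o app nil presented_group_mult
  show "\<one>\<^bsub>presented_group X R\<^esub> \<in> carrier (presented_group X R)" by simp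
  show "x \<otimes>\<^bsub>presented_group X R\<^esub> y \<in> carrier (presented_group X R)"
    if "x \<in> carrier (presented_group X R)" "y \<in> carrier (presented_group X R)" for x y
    using that by auto
  show "x \<otimes>\<^bsub>presented_group X R\<^esub> y \<otimes>\<^bsub>presented_group X R\<^esub> z
      = x \<otimes>\<^bsub>presented_group X R\<^esub> (y \<otimes>\<^bsub>presented_group X R\<^esub> z)"
    if "x \<in> carrier (presented_group X R)" "y \<in> carrier (presented_group X R)"
       "z \<in> carrier (presented_group X R)" for x y z
    using that by auto
  show "\<one>\<^bsub>presented_group X R\<^esub> \<otimes>\<^bsub>presented_group X R\<^esub> x = x"
    if "x \<in> carrier (presented_group X R)" for x
    using that by auto
  show "\<exists>y\<in>carrier (presented_group X R). y \<otimes>\<^bsub>presented_group X R\<^esub> x = \<one>\<^bsub>presented_group X R\<^esub>"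
    if "x \<in> carrier (presented_group X R)" for x
  proof -
    from that obtain u where u: "u \<in> gwords X" "x = pres_class X R u" by auto
    obtain v where "v \<in> gwords X" "pres_eq X R (v @ u) []" using gwords_inverse[OF u(1)] by blast
    then show ?thesis using u by (intro bexI[of _ "pres_class X R v"]) (auto simp: pres_class_eq_iff)
  qed
qed

primrec eval_gword :: "('b, 'c) monoid_scheme \<Rightarrow> ('x \<Rightarrow> 'b) \<Rightarrow> 'x gword \<Rightarrow> 'b"
where
  "eval_gword H f [] = \<one>\<^bsub>H\<^esub>"
| "eval_gword H f (a # w) = (if fst a then f (snd a) else inv\<^bsub>H\<^esub> f (snd a)) \<otimes>\<^bsub>H\<^esub> eval_gword H f w"

lemma presented_group_universal:
  assumes H: "group H" and f: "f ` X \<subseteq> carrier H"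
    and R: "\<And>u v. (u, v) \<in> R \<Longrightarrow> u \<in> gwords X \<Longrightarrow> v \<in> gwords X
              \<Longrightarrow> eval_gword H f u = eval_gword H f v"
  shows "\<exists>h \<in> hom (presented_group X R) H. \<forall>x\<in>X. h (pres_class X R [(True, x)]) = f x"
proof -
  interpret H: group H by (rule H)
  have cl: "eval_gword H f u \<in> carrier H" if "u \<in> gwords X" for u
    using that by (induction u) (use f in \<open>auto simp: gwords_def\<close>)
  have app: "eval_gword H f (u @ v) = eval_gword H f u \<otimes>\<^bsub>H\<^esub> eval_gword H f v"
    if "u \<in> gwords X" "v \<in> gwords X" for u v
    using that(1)
  proof (induction u)
    case Nil
    then show ?case using cl[OF that(2)] by simp
  next
    case (Cons a u)
    then have "snd a \<in> X" "u \<in> gwords X" by (auto simp: gwords_def)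
    then show ?case using Cons.IH f cl[OF that(2)] cl[of u] by (auto simp: H.m_assoc image_subset_iff)
  qed
  have eq: "eval_gword H f u = eval_gword H f v" if "pres_eq X R u v" for u v
    using that
  proof (induction rule: pres_eq.induct)
    case (append u u' v v')
    then show ?case using app pres_eq_gwords by metis
  next
    case (cancel x b)
    then show ?case using f by (cases b) (auto simp: image_subset_iff)
  qed (use R in auto)
  have sm: "pres_class X R u \<in> carrier (presented_group X R)" if "u \<in> gwords X" for u
    using that by (simp add: presented_group_def)
  define h where "h A = eval_gword H f (SOME u. u \<in> A)" for A
  have h: "h (pres_class X R u) = eval_gword H f u" if "u \<in> gwords X" for u
  proof -
    have "u \<in> pres_class X R u" using that by (simp add: pres_class_def pres_eq.refl)
    then have "(SOME v. v \<in> pres_class X R u) \<in> pres_class X R u" by (rule someI)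
    then show ?thesis using eq[of u] by (simp add: h_def pres_class_def)
  qed
  have "h \<in> hom (presented_group X R) H"
  proof (rule homI)
    fix A assume "A \<in> carrier (presented_group X R)"
    then show "h A \<in> carrier H" by (auto simp: presented_group_def h cl)
  next
    fix A B assume "A \<in> carrier (presented_group X R)" "B \<in> carrier (presented_group X R)"
    then obtain u v where uv: "u \<in> gwords X" "A = pres_class X R u" "v \<in> gwords X" "B = pres_class X R v"
      by (auto simp: presented_group_def)
    then have "u @ v \<in> gwords X" by (auto simp: gwords_def)
    then show "h (A \<otimes>\<^bsub>presented_group X R\<^esub> B) = h A \<otimes>\<^bsub>H\<^esub> h B"
      using uv by (simp add: presented_group_mult h app)
  qed
  moreover have "h (pres_class X R [(True, x)]) = f x" if "x \<in> X" for x
  proof -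
    have "[(True, x)] \<in> gwords X" using that by (simp add: gwords_def)
    then show ?thesis using that f by (auto simp: h)
  qed
  ultimately show ?thesis by blast
qed

definition lconj :: "('a, 'b) monoid_scheme \<Rightarrow> 'a \<Rightarrow> 'a \<Rightarrow> 'a"
  where "lconj G g x = g \<otimes>\<^bsub>G\<^esub> x \<otimes>\<^bsub>G\<^esub> inv\<^bsub>G\<^esub> g"

abbreviation sym_letter :: "'a \<Rightarrow> 'a \<Rightarrow> bool \<times> 'a \<times> 'a"
  where "sym_letter g h \<equiv> (True, (g, h))"

definition tensor_relations ::
  "('a, 'b) monoid_scheme \<Rightarrow> (('a \<times> 'a) gword \<times> ('a \<times> 'a) gword) set"
where "tensor_relations G =
    {([sym_letter (g \<otimes>\<^bsub>G\<^esub> g') h],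
      [sym_letter (lconj G g g') (lconj G g h), sym_letter g h])
      | g g' h. g \<in> carrier G \<and> g' \<in> carrier G \<and> h \<in> carrier G}
  \<union> {([sym_letter g (h \<otimes>\<^bsub>G\<^esub> h')],
      [sym_letter g h, sym_letter (lconj G h g) (lconj G h h')])
      | g h h'. g \<in> carrier G \<and> h \<in> carrier G \<and> h' \<in> carrier G}"

definition tensor_square :: "('a, 'b) monoid_scheme \<Rightarrow> ('a \<times> 'a) gword set monoid"
  where "tensor_square G = presented_group (carrier G \<times> carrier G) (tensor_relations G)"

definition tensor :: "('a, 'b) monoid_scheme \<Rightarrow> 'a \<Rightarrow> 'a \<Rightarrow> ('a \<times> 'a) gword set"
  where "tensor G g h = pres_class (carrier G \<times> carrier G) (tensor_relations G) [sym_letter g h]"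

definition nabla :: "('a, 'b) monoid_scheme \<Rightarrow> ('a \<times> 'a) gword set monoid"
  where "nabla G = subgroup_generated (tensor_square G) ((\<lambda>g. tensor G g g) ` carrier G)"

abbreviation cyc :: "nat \<Rightarrow> int monoid"
  where "cyc n \<equiv> integer_mod_group n"

abbreviation copies :: "'a monoid \<Rightarrow> nat \<Rightarrow> (nat \<Rightarrow> 'a) monoid"
  where "copies A k \<equiv> sum_group {..<k} (\<lambda>_. A)"

end

theory Submission
  imports Defs "HOL-Algebra.Multiplicative_Group" "HOL-Combinatorics.Permutations"
begin

text \<open>
  For abelian \<open>G\<close> conjugation is trivial, so \<open>g \<otimes> h\<close> is bimultiplicative; expanding
  \<open>gg' \<otimes> hh'\<close> in two ways shows that the tensor square is commutative. Let \<open>e\<^sub>i\<close> be a basis of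
  \<open>G\<close> with orders \<open>n\<^sub>i\<close>. By polarization \<open>\<nabla>(G)\<close> is spanned by the elements \<open>e\<^sub>i \<otimes> e\<^sub>i\<close> and
  \<open>(e\<^sub>i \<otimes> e\<^sub>j)(e\<^sub>j \<otimes> e\<^sub>i)\<close> with \<open>i < j\<close>, which have orders dividing \<open>gcd(n\<^sub>i, n\<^sub>j)\<close>. The
  homomorphisms to \<open>\<int>/gcd(n\<^sub>k, n\<^sub>l)\<close> induced by the bilinear maps \<open>(g, h) \<mapsto> g\<^sub>k h\<^sub>l\<close>, \<open>k \<le> l\<close>,
  separate these elements, so they form a basis of \<open>\<nabla>(G)\<close> with exactly these orders.
\<close>

section \<open>Coordinates on abelian groups\<close>

text \<open>
  For finite \<open>I\<close>, \<open>\<theta>\<close> exhibits \<open>G\<close> as \<open>\<int>\<^sup>I / \<Oplus>\<^sub>i n\<^sub>i\<int>\<close>. Exponent vectors are total functions, but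
  their values outside \<open>I\<close> do not matter; \<open>n\<^sub>i = 0\<close> gives an infinite cyclic factor.
\<close>

definition cyclic_coordinates ::
  "('g, 'b) monoid_scheme \<Rightarrow> 'i set \<Rightarrow> ('i \<Rightarrow> nat) \<Rightarrow> (('i \<Rightarrow> int) \<Rightarrow> 'g) \<Rightarrow> bool"
  where "cyclic_coordinates G I n \<theta> \<longleftrightarrow>
    range \<theta> = carrier G \<and>
    (\<forall>a b. \<theta> (\<lambda>i. a i + b i) = \<theta> a \<otimes>\<^bsub>G\<^esub> \<theta> b) \<and>
    (\<forall>a. \<theta> a = \<one>\<^bsub>G\<^esub> \<longleftrightarrow> (\<forall>i\<in>I. int (n i) dvd a i))"

lemma cyclic_coordinates_closed: "cyclic_coordinates G I n \<theta> \<Longrightarrow> \<theta> a \<in> carrier G"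
  unfolding cyclic_coordinates_def by blast

lemma cyclic_coordinates_add:
  "cyclic_coordinates G I n \<theta> \<Longrightarrow> \<theta> (\<lambda>i. a i + b i) = \<theta> a \<otimes>\<^bsub>G\<^esub> \<theta> b"
  unfolding cyclic_coordinates_def by blast

lemma cyclic_coordinates_one_iff:
  "cyclic_coordinates G I n \<theta> \<Longrightarrow> \<theta> a = \<one>\<^bsub>G\<^esub> \<longleftrightarrow> (\<forall>i\<in>I. int (n i) dvd a i)"
  unfolding cyclic_coordinates_def by blast

lemma cyclic_coordinates_surj:
  assumes "cyclic_coordinates G I n \<theta>" "g \<in> carrier G"
  obtains a where "g = \<theta> a"
  using assms unfolding cyclic_coordinates_def by blast

text \<open>Additivity reduces this to the kernel condition for the difference of \<open>a\<close>
  and \<open>b\<close>. It also allows values outside \<open>I\<close> to be changed freely.\<close>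

lemma cyclic_coordinates_eq_iff:
  assumes "group G" and \<theta>: "cyclic_coordinates G I n \<theta>"
  shows "\<theta> a = \<theta> b \<longleftrightarrow> (\<forall>i\<in>I. a i mod int (n i) = b i mod int (n i))"
proof -
  interpret group G by fact
  have "\<theta> a = \<theta> (\<lambda>i. a i - b i) \<otimes>\<^bsub>G\<^esub> \<theta> b"
    using cyclic_coordinates_add[OF \<theta>, of "\<lambda>i. a i - b i" b] by simp
  then have "\<theta> a = \<theta> b \<longleftrightarrow> \<theta> (\<lambda>i. a i - b i) = \<one>\<^bsub>G\<^esub>"
    using cyclic_coordinates_closed[OF \<theta>] by (simp add: r_cancel_one)
  then show ?thesis
    by (simp add: cyclic_coordinates_one_iff[OF \<theta>] mod_eq_dvd_iff)
qed

text \<open>After reindexing along \<open>f\<close>, both groups are quotients of integer vectors by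
  the same kernel.\<close>

lemma iso_if_cyclic_coordinates:
  assumes "group G" "group H"
    and \<theta>: "cyclic_coordinates G I n \<theta>" and \<eta>: "cyclic_coordinates H J m \<eta>"
    and f: "bij_betw f I J" and nm: "\<And>i. i \<in> I \<Longrightarrow> n i = m (f i)"
  shows "G \<cong> H"
proof -
  define c where "c g = (SOME a. \<theta> a = g)" for g
  define t where "t a = \<eta> (\<lambda>j. a (inv_into I f j))" for a
  have c: "\<theta> (c g) = g" if "g \<in> carrier G" for g
  proof -
    obtain a where "g = \<theta> a" using cyclic_coordinates_surj[OF \<theta> \<open>g \<in> carrier G\<close>] .
    then show ?thesis unfolding c_def by (intro someI[of "\<lambda>a. \<theta> a = g" a]) simp
  qed
  have f': "inv_into I f ` J = I"
    using bij_betw_inv_into[OF f] by (simp add: bij_betw_def)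
  have nm': "m j = n (inv_into I f j)" if "j \<in> J" for j
    using that f nm f' by (metis bij_betw_inv_into_right image_eqI)
  \<comment> \<open>From right to left this makes the choice in \<open>c\<close> harmless; from left
    to right it gives injectivity.\<close>
  have t_eq: "t a = t b \<longleftrightarrow> \<theta> a = \<theta> b" for a b
  proof -
    have "t a = t b \<longleftrightarrow> (\<forall>i\<in>inv_into I f ` J. a i mod int (n i) = b i mod int (n i))"
      unfolding t_def cyclic_coordinates_eq_iff[OF \<open>group H\<close> \<eta>] using nm' by auto
    then show ?thesis
      unfolding f' cyclic_coordinates_eq_iff[OF \<open>group G\<close> \<theta>] .
  qed
  have t_\<theta>: "t (c (\<theta> a)) = t a" for a
    by (simp add: t_eq c cyclic_coordinates_closed[OF \<theta>])
  have "t \<circ> c \<in> iso G H"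
  proof (rule isoI)
    show "t \<circ> c \<in> hom G H"
    proof (rule homI)
      show "(t \<circ> c) g \<in> carrier H" for g
        by (simp add: t_def cyclic_coordinates_closed[OF \<eta>])
      fix g h assume g: "g \<in> carrier G" and h: "h \<in> carrier G"
      have "g \<otimes>\<^bsub>G\<^esub> h = \<theta> (\<lambda>i. c g i + c h i)"
        using cyclic_coordinates_add[OF \<theta>] c[OF g] c[OF h] by simp
      then have "(t \<circ> c) (g \<otimes>\<^bsub>G\<^esub> h) = t (\<lambda>i. c g i + c h i)"
        by (simp add: t_\<theta>)
      then show "(t \<circ> c) (g \<otimes>\<^bsub>G\<^esub> h) = (t \<circ> c) g \<otimes>\<^bsub>H\<^esub> (t \<circ> c) h"
        by (simp add: t_def cyclic_coordinates_add[OF \<eta>])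
    qed
    show "bij_betw (t \<circ> c) (carrier G) (carrier H)"
    proof (rule bij_betw_imageI)
      show "inj_on (t \<circ> c) (carrier G)"
        by (rule inj_onI) (simp add: t_eq c)
      show "(t \<circ> c) ` carrier G = carrier H"
      proof
        show "(t \<circ> c) ` carrier G \<subseteq> carrier H"
          by (auto simp: t_def cyclic_coordinates_closed[OF \<eta>])
        show "carrier H \<subseteq> (t \<circ> c) ` carrier G"
        proof
          fix h assume "h \<in> carrier H"
          then obtain b where b: "h = \<eta> b" using cyclic_coordinates_surj[OF \<eta>] by blast
          have "t (\<lambda>i. b (f i)) = h"
            unfolding b t_def cyclic_coordinates_eq_iff[OF \<open>group H\<close> \<eta>]
            using f by (simp add: bij_betw_inv_into_right)
          then have "(t \<circ> c) (\<theta> (\<lambda>i. b (f i))) = h" by (simp add: t_\<theta>)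
          then show "h \<in> (t \<circ> c) ` carrier G"
            using cyclic_coordinates_closed[OF \<theta>] by blast
        qed
      qed
    qed
  qed
  then show ?thesis by (rule is_isoI)
qed

text \<open>The entries are the orders in some decomposition into cyclic factors. Neither prime
  powers nor a divisibility chain are demanded, so a group may have several such lists.\<close>

definition abelian_invariants :: "('g, 'b) monoid_scheme \<Rightarrow> nat list \<Rightarrow> bool"
  where "abelian_invariants G ns \<longleftrightarrow>
    group G \<and> (\<exists>\<theta>. cyclic_coordinates G {..<length ns} ((!) ns) \<theta>)"

lemma abelian_invariantsI:
  "group G \<Longrightarrow> cyclic_coordinates G {..<length ns} ((!) ns) \<theta> \<Longrightarrow> abelian_invariants G ns"
  unfolding abelian_invariants_def by blast

text \<open>A permutation matching the two lists serves as the bijection of indices.\<close>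

lemma abelian_invariants_imp_iso:
  assumes "abelian_invariants G ns" "abelian_invariants H ms" "mset ns = mset ms"
  shows "G \<cong> H"
proof -
  obtain p where p: "p permutes {..<length ms}" "permute_list p ms = ns"
    using mset_eq_permutation[OF assms(3)] .
  have l: "length ns = length ms" using assms(3) by (rule mset_eq_length)
  have "ns ! i = ms ! p i" if "i \<in> {..<length ns}" for i
    using p that l by (metis lessThan_iff permute_list_nth)
  moreover have "bij_betw p {..<length ns} {..<length ms}"
    using p(1) by (simp add: l permutes_imp_bij)
  ultimately show ?thesis
    using assms(1,2) iso_if_cyclic_coordinates unfolding abelian_invariants_def by blast
qed

section \<open>Invariants of cyclic groups, products and isomorphic copies\<close>

lemma abelian_invariants_cyc: "abelian_invariants (cyc n) [n]"
proof (rule abelian_invariantsI)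
  have "range (\<lambda>a::nat \<Rightarrow> int. a 0 mod int n) = carrier (cyc n)"
  proof (intro equalityI subsetI)
    fix x assume "x \<in> carrier (cyc n)"
    then have "x = x mod int n"
      by (auto simp: carrier_integer_mod_group split: if_splits)
    then show "x \<in> range (\<lambda>a::nat \<Rightarrow> int. a 0 mod int n)"
      by (rule image_eqI[where x = "\<lambda>_. x"]) simp
  qed (auto simp: carrier_integer_mod_group)
  then show "cyclic_coordinates (cyc n) {..<length [n]} ((!) [n]) (\<lambda>a. a 0 mod int n)"
    by (simp add: cyclic_coordinates_def mod_add_eq mod_eq_0_iff_dvd lessThan_Suc)
qed simp

lemma abelian_invariants_DirProd:
  assumes "abelian_invariants G ns" "abelian_invariants H ms"
  shows "abelian_invariants (G \<times>\<times> H) (ns @ ms)"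
proof -
  obtain \<theta> \<eta> where \<theta>: "cyclic_coordinates G {..<length ns} ((!) ns) \<theta>"
    and \<eta>: "cyclic_coordinates H {..<length ms} ((!) ms) \<eta>" and "group G" "group H"
    using assms unfolding abelian_invariants_def by blast
  define t where "t a = (\<theta> a, \<eta> (\<lambda>i. a (i + length ns)))" for a
  have "x \<in> range t" if "x \<in> carrier (G \<times>\<times> H)" for x
  proof -
    obtain g h where x: "x = (g, h)" "g \<in> carrier G" "h \<in> carrier H"
      using \<open>x \<in> carrier (G \<times>\<times> H)\<close> by (cases x) auto
    obtain a b where ab: "g = \<theta> a" "h = \<eta> b"
      using cyclic_coordinates_surj \<theta> \<eta> x by metis
    \<comment> \<open>The shift by \<open>length ns\<close> recovers \<open>b\<close> exactly; the
      first component sees \<open>a\<close> below \<open>length ns\<close>, which determines the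
      value of \<open>\<theta>\<close>.\<close>
    have "t (\<lambda>i. if i < length ns then a i else b (i - length ns)) = x"
      unfolding t_def x ab by (simp add: cyclic_coordinates_eq_iff[OF \<open>group G\<close> \<theta>])
    then show ?thesis by blast
  qed
  moreover have "range t \<subseteq> carrier (G \<times>\<times> H)"
    using cyclic_coordinates_closed[OF \<theta>] cyclic_coordinates_closed[OF \<eta>]
    by (auto simp: t_def DirProd_def)
  moreover have "t (\<lambda>i. a i + b i) = t a \<otimes>\<^bsub>G \<times>\<times> H\<^esub> t b" for a b
    by (simp add: t_def cyclic_coordinates_add[OF \<theta>] cyclic_coordinates_add[OF \<eta>])
  moreover have "t a = \<one>\<^bsub>G \<times>\<times> H\<^esub> \<longleftrightarrow> (\<forall>i\<in>{..<length (ns @ ms)}. int ((ns @ ms) ! i) dvd a i)" for a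
  proof -
    have *: "(\<forall>i<l + k. P i) \<longleftrightarrow> (\<forall>i<l. P i) \<and> (\<forall>i<k. P (i + l))" for P and l k :: nat
      by (metis add.commute add_less_cancel_left le_Suc_ex not_le trans_less_add1)
    show ?thesis
      by (simp add: t_def cyclic_coordinates_one_iff[OF \<theta>] cyclic_coordinates_one_iff[OF \<eta>]
          Ball_def * nth_append)
  qed
  ultimately have "cyclic_coordinates (G \<times>\<times> H) {..<length (ns @ ms)} ((!) (ns @ ms)) t"
    unfolding cyclic_coordinates_def by blast
  then show ?thesis
    using DirProd_group[OF \<open>group G\<close> \<open>group H\<close>] by (intro abelian_invariantsI)
qed

lemma abelian_invariants_copies_cyc: "abelian_invariants (copies (cyc n) k) (replicate k n)"
proof (rule abelian_invariantsI)
  \<comment> \<open>Elements of \<open>copies\<close> are extensional functions, hence the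
    restriction to \<open>{..<k}\<close>.\<close>
  let ?t = "\<lambda>a::nat \<Rightarrow> int. \<lambda>i\<in>{..<k}. a i mod int n"
  show "group (copies (cyc n) k)" by simp
  have c: "carrier (copies (cyc n) k) = (\<Pi>\<^sub>E i\<in>{..<k}. carrier (cyc n))"
    by (simp add: carrier_sum_group)
  have "x \<in> range ?t" if "x \<in> carrier (copies (cyc n) k)" for x
  proof -
    have "x i mod int n = x i" if "i < k" for i
      using that \<open>x \<in> _\<close> unfolding c
      by (auto simp: carrier_integer_mod_group PiE_iff split: if_splits)
    then have "x = ?t x" using that unfolding c by (auto simp: PiE_iff extensional_def)
    then show ?thesis by blast
  qed
  moreover have "range ?t \<subseteq> carrier (copies (cyc n) k)"
    unfolding c by (intro image_subsetI restrict_PiE_iff[THEN iffD2] ballI) (simp add: carrier_integer_mod_group)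
  moreover have "?t (\<lambda>i. a i + b i) = ?t a \<otimes>\<^bsub>copies (cyc n) k\<^esub> ?t b" for a b
    by (auto simp: mod_add_eq)
  moreover have "?t a = \<one>\<^bsub>copies (cyc n) k\<^esub> \<longleftrightarrow>
      (\<forall>i\<in>{..<length (replicate k n)}. int (replicate k n ! i) dvd a i)" for a
    by (auto simp: fun_eq_iff mod_eq_0_iff_dvd)
  ultimately show "cyclic_coordinates (copies (cyc n) k) {..<length (replicate k n)}
      ((!) (replicate k n)) ?t"
    unfolding cyclic_coordinates_def by blast
qed

text \<open>Compose the coordinates of \<open>H\<close> with an isomorphism back to
  \<open>G\<close>; injectivity preserves the kernel.\<close>

lemma abelian_invariants_iso:
  assumes "group G" "G \<cong> H" "abelian_invariants H ns"
  shows "abelian_invariants G ns"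
proof -
  obtain \<theta> where \<theta>: "cyclic_coordinates H {..<length ns} ((!) ns) \<theta>" and "group H"
    using assms(3) unfolding abelian_invariants_def by blast
  obtain h where h: "h \<in> iso H G"
    using assms(2) group.iso_sym[OF \<open>group G\<close>] unfolding is_iso_def by blast
  interpret h: group_hom H G h
    using h \<open>group G\<close> \<open>group H\<close> by (simp add: iso_def group_hom_def group_hom_axioms_def)
  have inj: "inj_on h (carrier H)" and im: "h ` carrier H = carrier G"
    using h by (auto simp: iso_def bij_betw_def)
  have "range (h \<circ> \<theta>) = carrier G"
    using im \<theta> by (metis cyclic_coordinates_def image_comp)
  moreover have "(h \<circ> \<theta>) a = \<one>\<^bsub>G\<^esub> \<longleftrightarrow> \<theta> a = \<one>\<^bsub>H\<^esub>" for a
    using inj cyclic_coordinates_closed[OF \<theta>, of a] h.inj_on_one_iff by auto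
  ultimately have "cyclic_coordinates G {..<length ns} ((!) ns) (h \<circ> \<theta>)"
    unfolding cyclic_coordinates_def
    by (simp add: cyclic_coordinates_add[OF \<theta>] cyclic_coordinates_one_iff[OF \<theta>]
        cyclic_coordinates_closed[OF \<theta>])
  then show ?thesis using \<open>group G\<close> by (intro abelian_invariantsI)
qed

section \<open>Auxiliary facts on products, powers and generation\<close>

lemma lconj_comm:
  assumes "comm_group G" "g \<in> carrier G" "x \<in> carrier G"
  shows "lconj G g x = x"
proof -
  interpret comm_group G by fact
  have "g \<otimes>\<^bsub>G\<^esub> x \<otimes>\<^bsub>G\<^esub> inv\<^bsub>G\<^esub> g = x \<otimes>\<^bsub>G\<^esub> (g \<otimes>\<^bsub>G\<^esub> inv\<^bsub>G\<^esub> g)"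
    using assms(2,3) by (simp only: m_ac inv_closed)
  then show ?thesis using assms(2,3) by (simp add: lconj_def)
qed

lemma finprod_hom:
  assumes "h \<in> hom G H" "comm_group G" "comm_group H" "f \<in> A \<rightarrow> carrier G"
  shows "h (finprod G f A) = finprod H (h \<circ> f) A"
proof -
  interpret G: comm_group G by fact
  interpret H: comm_group H by fact
  interpret group_hom G H h by unfold_locales fact
  show ?thesis
    using assms(4) by (induction A rule: infinite_finite_induct) (auto simp: Pi_def)
qed

lemma (in comm_monoid) finprod_eq_single:
  assumes "finite A" "i \<in> A" "f i \<in> carrier G" "\<And>j. \<lbrakk>j \<in> A; j \<noteq> i\<rbrakk> \<Longrightarrow> f j = \<one>"
  shows "finprod G f A = f i"
proof -
  have "finprod G f A = (\<Otimes>j\<in>A. if i = j then f i else \<one>)"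
    using assms(3,4) by (intro finprod_cong') auto
  also have "\<dots> = f i"
    using finprod_singleton[of i A "\<lambda>_. f i"] assms(1-3) by simp
  finally show ?thesis .
qed

text \<open>The order of \<open>x\<close> divides \<open>m\<close> and \<open>n\<close>, hence their
  gcd and \<open>a\<close>.\<close>

lemma (in group) int_pow_gcd_eq_one:
  assumes "x \<in> carrier G" "x [^] int m = \<one>" "x [^] int n = \<one>" "int (gcd m n) dvd a"
  shows "x [^] (a::int) = \<one>"
  using assms by (auto simp: int_pow_eq_id intro: dvd_trans[OF _ assms(4)])

text \<open>Combined with a generating set, this extends commutation from generators to all
  elements.\<close>

lemma (in group) subgroup_centralizer:
  assumes "S \<subseteq> carrier G"
  shows "subgroup {x \<in> carrier G. \<forall>y\<in>S. x \<otimes> y = y \<otimes> x} G"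
proof (rule subgroupI)
  show "{x \<in> carrier G. \<forall>y\<in>S. x \<otimes> y = y \<otimes> x} \<noteq> {}"
    using assms by (auto intro!: exI[of _ \<one>] simp: subset_eq)
next
  fix x assume x: "x \<in> {x \<in> carrier G. \<forall>y\<in>S. x \<otimes> y = y \<otimes> x}"
  have "inv x \<otimes> y = y \<otimes> inv x" if "y \<in> S" for y
  proof -
    have [simp]: "x \<in> carrier G" "y \<in> carrier G" "x \<otimes> y = y \<otimes> x" using x that assms by auto
    have "y = inv x \<otimes> (y \<otimes> x)" by (simp flip: \<open>x \<otimes> y = y \<otimes> x\<close> m_assoc)
    then show ?thesis by (simp add: inv_solve_right m_assoc)
  qed
  then show "inv x \<in> {x \<in> carrier G. \<forall>y\<in>S. x \<otimes> y = y \<otimes> x}"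
    using x by simp
next
  fix x x' assume x: "x \<in> {x \<in> carrier G. \<forall>y\<in>S. x \<otimes> y = y \<otimes> x}"
    "x' \<in> {x \<in> carrier G. \<forall>y\<in>S. x \<otimes> y = y \<otimes> x}"
  have "x \<otimes> x' \<otimes> y = y \<otimes> (x \<otimes> x')" if "y \<in> S" for y
  proof -
    have *: "x \<in> carrier G" "x' \<in> carrier G" "y \<in> carrier G" "x \<otimes> y = y \<otimes> x" "x' \<otimes> y = y \<otimes> x'"
      using x that assms by auto
    then have "x \<otimes> (x' \<otimes> y) = y \<otimes> x \<otimes> x'" by (simp flip: m_assoc)
    then show ?thesis using * by (simp add: m_assoc)
  qed
  then show "x \<otimes> x' \<in> {x \<in> carrier G. \<forall>y\<in>S. x \<otimes> y = y \<otimes> x}"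
    using x by simp
qed auto

text \<open>Multiples of one unit vector give a homomorphism from the integers, written
  \<open>cyc 0\<close>, and homomorphisms preserve powers.\<close>

lemma cyclic_coordinates_single:
  assumes "group G" and \<theta>: "cyclic_coordinates G I n \<theta>"
  shows "\<theta> ((\<lambda>_. 0)(i := m)) = \<theta> ((\<lambda>_. 0)(i := 1)) [^]\<^bsub>G\<^esub> m"
proof -
  have "(\<lambda>k. \<theta> ((\<lambda>_. 0)(i := k))) \<in> hom (cyc 0) G"
  proof (rule homI)
    fix k l :: int
    have "(\<lambda>_. 0)(i := k + l) = (\<lambda>j. ((\<lambda>_. 0)(i := k)) j + ((\<lambda>_. 0)(i := l)) j)"
      by auto
    then show "\<theta> ((\<lambda>_. 0)(i := k \<otimes>\<^bsub>cyc 0\<^esub> l)) =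
        \<theta> ((\<lambda>_. 0)(i := k)) \<otimes>\<^bsub>G\<^esub> \<theta> ((\<lambda>_. 0)(i := l))"
      by (simp flip: cyclic_coordinates_add[OF \<theta>])
  qed (rule cyclic_coordinates_closed[OF \<theta>])
  from hom_int_pow[OF this, of 1 m] show ?thesis
    using \<open>group G\<close> by (simp add: int_pow_integer_mod_group)
qed

text \<open>An exponent vector can be cut down to the finite set \<open>I\<close>, where it is a sum
  of multiples of unit vectors; the induction adds one index at a time.\<close>

lemma cyclic_coordinates_generated:
  assumes "group G" "finite I" and \<theta>: "cyclic_coordinates G I n \<theta>"
    and K: "subgroup K G" and e: "\<And>i. i \<in> I \<Longrightarrow> \<theta> ((\<lambda>_. 0)(i := 1)) \<in> K"
  shows "K = carrier G"
proof
  interpret group G by fact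
  show "K \<subseteq> carrier G" using K by (rule subgroup.subset)
  have "\<theta> (\<lambda>i. if i \<in> J then a i else 0) \<in> K" if "finite J" "J \<subseteq> I" for J a
    using that
  proof (induction J)
    case empty
    have "\<theta> (\<lambda>_. 0) = \<one>\<^bsub>G\<^esub>" by (simp add: cyclic_coordinates_one_iff[OF \<theta>])
    then show ?case using subgroup.one_closed[OF K] by simp
  next
    case (insert x J)
    have "(\<lambda>i. if i \<in> insert x J then a i else 0) =
        (\<lambda>i. (if i \<in> J then a i else 0) + ((\<lambda>_. 0)(x := a x)) i)"
      using insert.hyps by auto
    then have "\<theta> (\<lambda>i. if i \<in> insert x J then a i else 0) =
        \<theta> (\<lambda>i. if i \<in> J then a i else 0) \<otimes>\<^bsub>G\<^esub> \<theta> ((\<lambda>_. 0)(x := 1)) [^]\<^bsub>G\<^esub> a x"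
      by (simp only: cyclic_coordinates_add[OF \<theta>] cyclic_coordinates_single[OF \<open>group G\<close> \<theta>, of x "a x"])
    then show ?case
      using insert e subgroup.m_closed[OF K] subgroup_int_pow_closed[OF K] by simp
  qed
  moreover have "\<theta> a = \<theta> (\<lambda>i. if i \<in> I then a i else 0)" for a
    by (simp add: cyclic_coordinates_eq_iff[OF \<open>group G\<close> \<theta>])
  ultimately show "carrier G \<subseteq> K"
    using \<open>finite I\<close> cyclic_coordinates_surj[OF \<theta>] by (metis order_refl subsetI)
qed

lemma (in comm_group) subgroup_finprod_closed:
  assumes "subgroup K G" "f \<in> A \<rightarrow> K"
  shows "finprod G f A \<in> K"
  using assms(2)
proof (induction A rule: infinite_finite_induct)
  case (insert x F)
  then have "f \<in> F \<rightarrow> carrier G" "f x \<in> carrier G"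
    using subgroup.subset[OF assms(1)] by auto
  then show ?case
    using insert subgroup.m_closed[OF assms(1)] by (auto simp: Pi_def)
qed (use subgroup.one_closed[OF assms(1)] in auto)

section \<open>Tensor squares of abelian groups\<close>

context
  fixes G :: "('a, 'b) monoid_scheme"
  assumes comm: "comm_group G"
begin

interpretation G: comm_group G by (rule comm)

interpretation T: group "tensor_square G"
  unfolding tensor_square_def by (rule group_presented_group)

private abbreviation "T \<equiv> tensor_square G"

private abbreviation tensor_of (infixl "\<bullet>" 80) where "g \<bullet> h \<equiv> tensor G g h"

section \<open>Bilinearity and commutativity of the tensor square\<close>

lemma tensor_closed [simp]:
  assumes "g \<in> carrier G" "h \<in> carrier G"
  shows "g \<bullet> h \<in> carrier T"
  using assms by (auto simp: tensor_def tensor_square_def presented_group_def gwords_def)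

lemma tensor_mult_class:
  assumes "g \<in> carrier G" "h \<in> carrier G" "g' \<in> carrier G" "h' \<in> carrier G"
  shows "g \<bullet> h \<otimes>\<^bsub>T\<^esub> g' \<bullet> h' =
    pres_class (carrier G \<times> carrier G) (tensor_relations G) [sym_letter g h, sym_letter g' h']"
  using assms unfolding tensor_def tensor_square_def
  by (subst presented_group_mult) (auto simp: gwords_def)

text \<open>Conjugation is trivial, so the defining relation applies with its own order of factors;
  commutativity of the tensor square is derived from it only later.\<close>

lemma tensor_mult_left_rev:
  assumes "g \<in> carrier G" "g' \<in> carrier G" "h \<in> carrier G"
  shows "(g \<otimes>\<^bsub>G\<^esub> g') \<bullet> h = g' \<bullet> h \<otimes>\<^bsub>T\<^esub> g \<bullet> h"
proof -
  have "([sym_letter (g \<otimes>\<^bsub>G\<^esub> g') h], [sym_letter g' h, sym_letter g h]) \<in> tensor_relations G"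
    using assms unfolding tensor_relations_def
    by (intro UnI1 CollectI exI[of _ g] exI[of _ g'] exI[of _ h]) (simp add: lconj_comm[OF comm])
  then have "pres_eq (carrier G \<times> carrier G) (tensor_relations G)
      [sym_letter (g \<otimes>\<^bsub>G\<^esub> g') h] [sym_letter g' h, sym_letter g h]"
    using assms by (intro pres_eq.rel) (auto simp: gwords_def)
  then show ?thesis
    using assms by (simp add: tensor_mult_class) (simp add: tensor_def pres_class_eq_iff gwords_def)
qed

lemma tensor_mult_right:
  assumes "g \<in> carrier G" "h \<in> carrier G" "h' \<in> carrier G"
  shows "g \<bullet> (h \<otimes>\<^bsub>G\<^esub> h') = g \<bullet> h \<otimes>\<^bsub>T\<^esub> g \<bullet> h'"
proof -
  have "([sym_letter g (h \<otimes>\<^bsub>G\<^esub> h')], [sym_letter g h, sym_letter g h']) \<in> tensor_relations G"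
    using assms unfolding tensor_relations_def
    by (intro UnI2 CollectI exI[of _ g] exI[of _ h] exI[of _ h']) (simp add: lconj_comm[OF comm])
  then have "pres_eq (carrier G \<times> carrier G) (tensor_relations G)
      [sym_letter g (h \<otimes>\<^bsub>G\<^esub> h')] [sym_letter g h, sym_letter g h']"
    using assms by (intro pres_eq.rel) (auto simp: gwords_def)
  then show ?thesis
    using assms by (simp add: tensor_mult_class) (simp add: tensor_def pres_class_eq_iff gwords_def)
qed

text \<open>Expand the tensor of the two products by the left argument first, then by the right
  argument first. Cancelling the common outer factors \<open>g' \<bullet> h\<close> and
  \<open>g \<bullet> h'\<close> leaves the claim.\<close>

lemma tensor_commute:
  assumes [simp]: "g \<in> carrier G" "h \<in> carrier G" "g' \<in> carrier G" "h' \<in> carrier G"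
  shows "g' \<bullet> h' \<otimes>\<^bsub>T\<^esub> g \<bullet> h = g \<bullet> h \<otimes>\<^bsub>T\<^esub> g' \<bullet> h'"
proof -
  have "g' \<bullet> h \<otimes>\<^bsub>T\<^esub> (g' \<bullet> h' \<otimes>\<^bsub>T\<^esub> (g \<bullet> h \<otimes>\<^bsub>T\<^esub> g \<bullet> h'))
      = (g \<otimes>\<^bsub>G\<^esub> g') \<bullet> (h \<otimes>\<^bsub>G\<^esub> h')"
    by (subst tensor_mult_left_rev) (simp_all add: tensor_mult_right T.m_assoc)
  also have "\<dots> = (g \<otimes>\<^bsub>G\<^esub> g') \<bullet> h \<otimes>\<^bsub>T\<^esub> (g \<otimes>\<^bsub>G\<^esub> g') \<bullet> h'"
    by (rule tensor_mult_right) auto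
  also have "\<dots> = g' \<bullet> h \<otimes>\<^bsub>T\<^esub> (g \<bullet> h \<otimes>\<^bsub>T\<^esub> (g' \<bullet> h' \<otimes>\<^bsub>T\<^esub> g \<bullet> h'))"
    by (simp add: tensor_mult_left_rev T.m_assoc)
  finally have "g' \<bullet> h' \<otimes>\<^bsub>T\<^esub> g \<bullet> h \<otimes>\<^bsub>T\<^esub> g \<bullet> h' = g \<bullet> h \<otimes>\<^bsub>T\<^esub> g' \<bullet> h' \<otimes>\<^bsub>T\<^esub> g \<bullet> h'"
    by (simp add: T.m_assoc)
  then show ?thesis by simp
qed

text \<open>A word is a product of letters, and the class of each letter is a tensor or the inverse
  of one.\<close>

lemma tensor_square_generated:
  assumes "subgroup K T" and "\<And>g h. g \<in> carrier G \<Longrightarrow> h \<in> carrier G \<Longrightarrow> g \<bullet> h \<in> K"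
  shows "K = carrier T"
proof
  show "K \<subseteq> carrier T" using assms(1) by (rule subgroup.subset)
  have letter: "pres_class (carrier G \<times> carrier G) (tensor_relations G) [(b, g, h)] \<in> K"
    if g: "g \<in> carrier G" and h: "h \<in> carrier G" for b g h
  proof (cases b)
    case True
    then show ?thesis using assms(2)[OF g h] by (simp add: tensor_def)
  next
    case False
    let ?c = "pres_class (carrier G \<times> carrier G) (tensor_relations G)"
    \<comment> \<open>Free cancellation identifies the class of a formal inverse letter with the
      inverse of the tensor.\<close>
    have "pres_eq (carrier G \<times> carrier G) (tensor_relations G) [(False, g, h), (True, g, h)] []"
      using pres_eq.cancel[of "(g, h)" _ _ False] g h by simp
    then have "?c [(False, g, h)] \<otimes>\<^bsub>T\<^esub> g \<bullet> h = \<one>\<^bsub>T\<^esub>"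
      using g h unfolding tensor_def tensor_square_def
      by (subst presented_group_mult) (auto simp: gwords_def pres_class_eq_iff presented_group_def)
    moreover have "?c [(False, g, h)] \<in> carrier T"
      using g h by (auto simp: tensor_square_def presented_group_def gwords_def)
    ultimately have "?c [(False, g, h)] = inv\<^bsub>T\<^esub> (g \<bullet> h)"
      using g h by (intro T.inv_equality[symmetric]) auto
    then show ?thesis using False assms g h by (simp add: subgroup.m_inv_closed)
  qed
  have "pres_class (carrier G \<times> carrier G) (tensor_relations G) u \<in> K"
    if "u \<in> gwords (carrier G \<times> carrier G)" for u
    using that
  proof (induction u)
    case Nil
    then show ?case
      using subgroup.one_closed[OF assms(1)] by (simp add: tensor_square_def presented_group_def)
  next
    case (Cons a u)
    obtain b g h where a: "a = (b, g, h)" by (cases a)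
    have u: "g \<in> carrier G" "h \<in> carrier G" "u \<in> gwords (carrier G \<times> carrier G)"
      using Cons.prems by (auto simp: gwords_def a)
    have "pres_class (carrier G \<times> carrier G) (tensor_relations G) (a # u) =
        pres_class (carrier G \<times> carrier G) (tensor_relations G) [(b, g, h)] \<otimes>\<^bsub>T\<^esub>
        pres_class (carrier G \<times> carrier G) (tensor_relations G) u"
      using u unfolding tensor_square_def
      by (subst presented_group_mult) (auto simp: gwords_def a)
    then show ?case
      using letter[OF u(1,2)] Cons.IH[OF u(3)] subgroup.m_closed[OF assms(1)] by simp
  qed
  then show "carrier T \<subseteq> K"
    by (auto simp: tensor_square_def presented_group_def)
qed

lemma comm_group_tensor_square: "comm_group T"
proof (rule T.group_comm_groupI)
  let ?S = "{g \<bullet> h | g h. g \<in> carrier G \<and> h \<in> carrier G}"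
  have "?S \<subseteq> carrier T" by auto
  \<comment> \<open>First pass: the centralizer of the tensors contains every tensor by
    \<open>tensor_commute\<close>, so it is the whole group.\<close>
  then have "{x \<in> carrier T. \<forall>y\<in>?S. x \<otimes>\<^bsub>T\<^esub> y = y \<otimes>\<^bsub>T\<^esub> x} = carrier T"
    by (intro tensor_square_generated T.subgroup_centralizer) (auto simp: tensor_commute)
  then have 1: "\<forall>x\<in>carrier T. \<forall>y\<in>?S. x \<otimes>\<^bsub>T\<^esub> y = y \<otimes>\<^bsub>T\<^esub> x" by blast
  \<comment> \<open>Second pass: all tensors are therefore central, so the center is the whole
    group.\<close>
  have "{x \<in> carrier T. \<forall>y\<in>carrier T. x \<otimes>\<^bsub>T\<^esub> y = y \<otimes>\<^bsub>T\<^esub> x} = carrier T"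
  proof (intro tensor_square_generated T.subgroup_centralizer subset_refl)
    fix g h assume gh: "g \<in> carrier G" "h \<in> carrier G"
    then have "g \<bullet> h \<in> ?S" by blast
    then have "g \<bullet> h \<otimes>\<^bsub>T\<^esub> x = x \<otimes>\<^bsub>T\<^esub> g \<bullet> h" if "x \<in> carrier T" for x
      using 1 that by (metis (no_types, lifting))
    then show "g \<bullet> h \<in> {x \<in> carrier T. \<forall>y\<in>carrier T. x \<otimes>\<^bsub>T\<^esub> y = y \<otimes>\<^bsub>T\<^esub> x}"
      using gh by simp
  qed
  then have "\<forall>x\<in>carrier T. \<forall>y\<in>carrier T. x \<otimes>\<^bsub>T\<^esub> y = y \<otimes>\<^bsub>T\<^esub> x" by blast
  then show "x \<otimes>\<^bsub>T\<^esub> y = y \<otimes>\<^bsub>T\<^esub> x" if "x \<in> carrier T" "y \<in> carrier T" for x y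
    using that by blast
qed

interpretation T: comm_group T by (rule comm_group_tensor_square)

lemma tensor_mult_left:
  assumes "g \<in> carrier G" "g' \<in> carrier G" "h \<in> carrier G"
  shows "(g \<otimes>\<^bsub>G\<^esub> g') \<bullet> h = g \<bullet> h \<otimes>\<^bsub>T\<^esub> g' \<bullet> h"
  using assms by (subst tensor_mult_left_rev) (simp_all add: T.m_comm)

section \<open>Bilinear maps and the universal property\<close>

lemma tensor_hom_left: "h \<in> carrier G \<Longrightarrow> (\<lambda>g. g \<bullet> h) \<in> hom G T"
  by (intro homI) (auto simp: tensor_mult_left)

lemma tensor_hom_right: "g \<in> carrier G \<Longrightarrow> (\<lambda>h. g \<bullet> h) \<in> hom G T"
  by (intro homI) (auto simp: tensor_mult_right)

text \<open>With trivial conjugation the relations become bilinearity of \<open>B\<close>;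
  commutativity of \<open>H\<close> absorbs the reversed order of factors in the left
  relation.\<close>

lemma tensor_square_universal:
  assumes H: "comm_group H"
    and closed: "\<And>g h. g \<in> carrier G \<Longrightarrow> h \<in> carrier G \<Longrightarrow> B g h \<in> carrier H"
    and left: "\<And>g g' h. \<lbrakk>g \<in> carrier G; g' \<in> carrier G; h \<in> carrier G\<rbrakk>
      \<Longrightarrow> B (g \<otimes>\<^bsub>G\<^esub> g') h = B g h \<otimes>\<^bsub>H\<^esub> B g' h"
    and right: "\<And>g h h'. \<lbrakk>g \<in> carrier G; h \<in> carrier G; h' \<in> carrier G\<rbrakk>
      \<Longrightarrow> B g (h \<otimes>\<^bsub>G\<^esub> h') = B g h \<otimes>\<^bsub>H\<^esub> B g h'"
  shows "\<exists>\<phi>\<in>hom T H. \<forall>g\<in>carrier G. \<forall>h\<in>carrier G. \<phi> (g \<bullet> h) = B g h"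
proof -
  interpret H: comm_group H by (rule H)
  have "\<exists>\<phi>\<in>hom T H. \<forall>x\<in>carrier G \<times> carrier G.
      \<phi> (pres_class (carrier G \<times> carrier G) (tensor_relations G) [(True, x)]) = case_prod B x"
    unfolding tensor_square_def
  proof (rule presented_group_universal)
    show "case_prod B ` (carrier G \<times> carrier G) \<subseteq> carrier H" using closed by auto
    show "eval_gword H (case_prod B) u = eval_gword H (case_prod B) v"
      if "(u, v) \<in> tensor_relations G" for u v
      using that unfolding tensor_relations_def
      by (auto simp: lconj_comm[OF comm] left right closed H.m_comm)
  qed (rule H.group_axioms)
  then show ?thesis by (simp add: tensor_def)
qed

text \<open>These are the four terms of the bilinear expansion with the mixed ones grouped, so a
  subgroup containing the diagonal tensors contains the mixed product.\<close>

lemma polarization: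
  assumes [simp]: "g \<in> carrier G" "h \<in> carrier G"
  shows "(g \<otimes>\<^bsub>G\<^esub> h) \<bullet> (g \<otimes>\<^bsub>G\<^esub> h) =
    g \<bullet> g \<otimes>\<^bsub>T\<^esub> h \<bullet> h \<otimes>\<^bsub>T\<^esub> (g \<bullet> h \<otimes>\<^bsub>T\<^esub> h \<bullet> g)"
  by (simp add: tensor_mult_left tensor_mult_right T.m_assoc T.m_comm T.m_lcomm)

text \<open>The symmetrized product \<open>?b\<close> is bilinear, so membership in \<open>M\<close>
  spreads from the basis to all arguments. Polarization then makes the set of \<open>g\<close> with
  \<open>g \<bullet> g\<close> in \<open>M\<close> a subgroup containing the basis.\<close>

lemma diagonal_in_subgroup:
  assumes "finite I" and \<theta>: "cyclic_coordinates G I n \<theta>" and M: "subgroup M T"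
    and e: "e = (\<lambda>i. \<theta> ((\<lambda>_. 0)(i := 1)))"
    and diag: "\<And>i. i \<in> I \<Longrightarrow> e i \<bullet> e i \<in> M"
    and off: "\<And>i j. i \<in> I \<Longrightarrow> j \<in> I \<Longrightarrow> e i \<bullet> e j \<otimes>\<^bsub>T\<^esub> e j \<bullet> e i \<in> M"
    and g: "g \<in> carrier G"
  shows "g \<bullet> g \<in> M"
proof -
  let ?b = "\<lambda>g h. g \<bullet> h \<otimes>\<^bsub>T\<^esub> h \<bullet> g"
  have gen: "K = carrier G" if "subgroup K G" "\<And>i. i \<in> I \<Longrightarrow> e i \<in> K" for K
    using cyclic_coordinates_generated[OF G.group_axioms \<open>finite I\<close> \<theta>] that e by blast
  have ec [simp]: "e i \<in> carrier G" for i
    by (simp add: e cyclic_coordinates_closed[OF \<theta>])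
  have hom: "(\<lambda>g. ?b g h) \<in> hom G T" if "h \<in> carrier G" for h
    using that
    by (intro homI) (simp_all add: tensor_mult_left tensor_mult_right T.m_ac)
  have sub: "subgroup {g \<in> carrier G. ?b g h \<in> M} G" if h: "h \<in> carrier G" for h
  proof -
    interpret b: group_hom G T "\<lambda>g. ?b g h"
      using hom[OF h] by unfold_locales
    show ?thesis
    proof (rule G.subgroupI)
      show "{g \<in> carrier G. ?b g h \<in> M} \<noteq> {}"
        using b.hom_one subgroup.one_closed[OF M] by (auto intro!: exI[of _ "\<one>\<^bsub>G\<^esub>"])
      show "inv\<^bsub>G\<^esub> g \<in> {g \<in> carrier G. ?b g h \<in> M}" if "g \<in> {g \<in> carrier G. ?b g h \<in> M}" for g
        using that b.hom_inv subgroup.m_inv_closed[OF M] by simp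
      show "g \<otimes>\<^bsub>G\<^esub> g' \<in> {g \<in> carrier G. ?b g h \<in> M}"
        if "g \<in> {g \<in> carrier G. ?b g h \<in> M}" "g' \<in> {g \<in> carrier G. ?b g h \<in> M}" for g g'
        using that b.hom_mult subgroup.m_closed[OF M] by simp
    qed auto
  qed
  have 1: "?b g (e j) \<in> M" if "j \<in> I" "g \<in> carrier G" for g j
    using gen[OF sub[of "e j"]] off that by auto
  \<comment> \<open>Symmetry of \<open>?b\<close> lets the extension in the first argument serve for
    the second one too.\<close>
  have 2: "?b g h \<in> M" if "g \<in> carrier G" "h \<in> carrier G" for g h
    using gen[OF sub[of h]] 1 that by (auto simp: T.m_comm)
  have "{g \<in> carrier G. g \<bullet> g \<in> M} = carrier G"
  proof (rule gen[OF G.subgroupI])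
    fix g assume g: "g \<in> {g \<in> carrier G. g \<bullet> g \<in> M}"
    interpret l: group_hom G T "\<lambda>h. h \<bullet> (inv\<^bsub>G\<^esub> g)"
      using g by unfold_locales (simp add: tensor_hom_left)
    interpret r: group_hom G T "\<lambda>h. g \<bullet> h"
      using g by unfold_locales (simp add: tensor_hom_right)
    \<comment> \<open>Inverting both arguments inverts the tensor twice.\<close>
    have "(inv\<^bsub>G\<^esub> g) \<bullet> (inv\<^bsub>G\<^esub> g) = g \<bullet> g"
      using g by (simp add: l.hom_inv r.hom_inv)
    then show "inv\<^bsub>G\<^esub> g \<in> {g \<in> carrier G. g \<bullet> g \<in> M}"
      using g by simp
  next
    fix g h assume gh: "g \<in> {g \<in> carrier G. g \<bullet> g \<in> M}" "h \<in> {g \<in> carrier G. g \<bullet> g \<in> M}"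
    then have "g \<bullet> g \<otimes>\<^bsub>T\<^esub> h \<bullet> h \<otimes>\<^bsub>T\<^esub> (g \<bullet> h \<otimes>\<^bsub>T\<^esub> h \<bullet> g) \<in> M"
      using 2 by (simp add: subgroup.m_closed[OF M])
    then show "g \<otimes>\<^bsub>G\<^esub> h \<in> {g \<in> carrier G. g \<bullet> g \<in> M}"
      using gh by (simp add: polarization)
  next
    have "\<one>\<^bsub>G\<^esub> \<bullet> \<one>\<^bsub>G\<^esub> = \<one>\<^bsub>T\<^esub>"
      using hom_one[OF tensor_hom_left[OF G.one_closed]] G.group_axioms T.group_axioms by blast
    then show "{g \<in> carrier G. g \<bullet> g \<in> M} \<noteq> {}"
      using subgroup.one_closed[OF M] by (auto intro!: exI[of _ "\<one>\<^bsub>G\<^esub>"])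
  qed (use diag in auto)
  then show ?thesis using g by blast
qed

text \<open>Pairs with \<open>i \<le> j\<close> suffice because \<open>(i, j)\<close> and
  \<open>(j, i)\<close> give the same mixed element. On the diagonal \<open>s\<close> takes
  \<open>e i \<bullet> e i\<close> itself, since the mixed formula would only give its
  square.\<close>

lemma nabla_cyclic_coordinates:
  fixes I :: "'i::linorder set"
  assumes "finite I" and \<theta>: "cyclic_coordinates G I n \<theta>"
    and e: "e = (\<lambda>i. \<theta> ((\<lambda>_. 0)(i := 1)))"
    and s: "s = (\<lambda>(i, j). if i = j then e i \<bullet> e i else e i \<bullet> e j \<otimes>\<^bsub>T\<^esub> e j \<bullet> e i)"
    and P: "P = {(i, j). i \<in> I \<and> j \<in> I \<and> i \<le> j}"
  shows "cyclic_coordinates (nabla G) P (\<lambda>(i, j). gcd (n i) (n j))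
    (\<lambda>c. finprod T (\<lambda>p. s p [^]\<^bsub>T\<^esub> c p) P)"
proof -
  define \<Theta> where "\<Theta> c = finprod T (\<lambda>p. s p [^]\<^bsub>T\<^esub> c p) P" for c :: "'i \<times> 'i \<Rightarrow> int"
  define N where "N = carrier (nabla G)"
  have "finite P" using \<open>finite I\<close> 
    by (intro finite_subset[OF _ finite_cartesian_product[of I I]]) (auto simp: P)
  have ec [simp]: "e i \<in> carrier G" for i
    by (simp add: e cyclic_coordinates_closed[OF \<theta>])
  have sc [simp]: "s p \<in> carrier T" for p
    by (cases p) (simp add: s)
  have add: "\<Theta> (\<lambda>p. a p + b p) = \<Theta> a \<otimes>\<^bsub>T\<^esub> \<Theta> b" for a b
    by (simp add: \<Theta>_def T.int_pow_mult T.finprod_multf)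
  have closed: "\<Theta> a \<in> carrier T" for a
    by (simp add: \<Theta>_def)
  have zero: "\<Theta> (\<lambda>_. 0) = \<one>\<^bsub>T\<^esub>"
    by (simp add: \<Theta>_def)
  have M: "subgroup (range \<Theta>) T"
  proof (rule T.subgroupI)
    fix x assume "x \<in> range \<Theta>"
    then obtain a where a: "x = \<Theta> a" by blast
    have "\<Theta> (\<lambda>p. - a p) \<otimes>\<^bsub>T\<^esub> \<Theta> a = \<one>\<^bsub>T\<^esub>"
      using zero by (simp flip: add)
    then have "inv\<^bsub>T\<^esub> x = \<Theta> (\<lambda>p. - a p)"
      unfolding a by (intro T.inv_equality closed)
    then show "inv\<^bsub>T\<^esub> x \<in> range \<Theta>" by blast
  next
    fix x y assume "x \<in> range \<Theta>" "y \<in> range \<Theta>"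
    then show "x \<otimes>\<^bsub>T\<^esub> y \<in> range \<Theta>" by (auto simp flip: add)
  qed (use closed in auto)
  have "s p \<in> range \<Theta>" if "p \<in> P" for p
  proof -
    have "\<Theta> ((\<lambda>_. 0)(p := 1)) = s p"
      unfolding \<Theta>_def
      by (subst T.finprod_eq_single[of P p]) (use that \<open>finite P\<close> T.int_pow_1[OF sc] in simp_all)
    then have "s p = \<Theta> ((\<lambda>_. 0)(p := 1))" by simp
    then show ?thesis by (simp only: rangeI)
  qed
  note s_range = this
  \<comment> \<open>\<open>N\<close> is the least subgroup containing the diagonal tensors; both
    inclusions below rest on this description.\<close>
  have N: "subgroup N T" "\<And>g. g \<in> carrier G \<Longrightarrow> g \<bullet> g \<in> N"
    "\<And>K. subgroup K T \<Longrightarrow> (\<And>g. g \<in> carrier G \<Longrightarrow> g \<bullet> g \<in> K) \<Longrightarrow> N \<subseteq> K"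
  proof -
    let ?D = "(\<lambda>g. g \<bullet> g) ` carrier G"
    have N_eq: "N = carrier (subgroup_generated T ?D)"
      by (simp add: N_def nabla_def)
    have D: "?D \<subseteq> carrier T" by auto
    show "subgroup N T" unfolding N_eq by (rule T.subgroup_subgroup_generated)
    show "g \<bullet> g \<in> N" if "g \<in> carrier G" for g
      using T.subgroup_generated_subset_carrier_subset[OF D] that unfolding N_eq by blast
    show "N \<subseteq> K" if "subgroup K T" "\<And>g. g \<in> carrier G \<Longrightarrow> g \<bullet> g \<in> K" for K
      unfolding N_eq using that by (intro T.subgroup_generated_minimal) auto
  qed
  have N_sub: "N \<subseteq> range \<Theta>"
  proof (rule N(3)[OF M])
    fix g assume "g \<in> carrier G"
    then show "g \<bullet> g \<in> range \<Theta>"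
    proof (rule diagonal_in_subgroup[OF \<open>finite I\<close> \<theta> M e, rotated 2])
      show "e i \<bullet> e i \<in> range \<Theta>" if "i \<in> I" for i
        using s_range[of "(i, i)"] that by (simp add: s P)
      then show "e i \<bullet> e j \<otimes>\<^bsub>T\<^esub> e j \<bullet> e i \<in> range \<Theta>" if "i \<in> I" "j \<in> I" for i j
      proof (cases i j rule: linorder_cases)
        case less
        then have "i \<le> j" "i \<noteq> j" by auto
        then show ?thesis using s_range[of "(i, j)"] that by (simp add: s P)
      next
        case equal
        then show ?thesis
          using \<open>\<And>i. i \<in> I \<Longrightarrow> e i \<bullet> e i \<in> range \<Theta>\<close> that subgroup.m_closed[OF M] by simp
      next
        case greater
        then have "j \<le> i" "j \<noteq> i" by auto
        then show ?thesis using s_range[of "(j, i)"] that by (simp add: s P T.m_comm)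
      qed
    qed
  qed
  have sub_N: "range \<Theta> \<subseteq> N"
  proof -
    have "s p \<in> N" for p
    proof (cases p)
      case (Pair i j)
      let ?x = "e i \<bullet> e i \<otimes>\<^bsub>T\<^esub> e j \<bullet> e j"
      let ?y = "e i \<bullet> e j \<otimes>\<^bsub>T\<^esub> e j \<bullet> e i"
      \<comment> \<open>Polarization solved for the mixed part: the product of \<open>?x\<close> and
        \<open>?y\<close> is the diagonal tensor of the product of \<open>e i\<close> and
        \<open>e j\<close>.\<close>
      have "?y = inv\<^bsub>T\<^esub> ?x \<otimes>\<^bsub>T\<^esub> (?x \<otimes>\<^bsub>T\<^esub> ?y)"
        by (subst T.inv_solve_left) simp_all
      moreover have "?x \<otimes>\<^bsub>T\<^esub> ?y \<in> N"
        using N(2)[of "e i \<otimes>\<^bsub>G\<^esub> e j"] by (simp add: polarization)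
      moreover have "?x \<in> N"
        by (intro subgroup.m_closed[OF N(1)] N(2)) simp_all
      ultimately have "?y \<in> N"
        by (metis subgroup.m_closed[OF N(1)] subgroup.m_inv_closed[OF N(1)])
      then show ?thesis using N(2) Pair by (simp add: s)
    qed
    then show ?thesis
      unfolding \<Theta>_def using N(1)
      by (auto intro!: T.subgroup_finprod_closed T.subgroup_int_pow_closed)
  qed
  have vanishes: "\<Theta> c = \<one>\<^bsub>T\<^esub>" if c: "\<forall>p\<in>P. int ((\<lambda>(i, j). gcd (n i) (n j)) p) dvd c p" for c
    unfolding \<Theta>_def
  proof (rule T.finprod_one_eqI)
    fix p assume "p \<in> P"
    obtain i j where p: "p = (i, j)" by (cases p)
    have e_pow: "e i [^]\<^bsub>G\<^esub> int (n i) = \<one>\<^bsub>G\<^esub>" for i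
      unfolding e cyclic_coordinates_single[OF G.group_axioms \<theta>, symmetric]
      by (simp add: cyclic_coordinates_one_iff[OF \<theta>])
    \<comment> \<open>The relation killing a basis element can be applied in either argument, so
      both orders kill the tensor.\<close>
    have left: "(e i \<bullet> e j) [^]\<^bsub>T\<^esub> int (n i) = \<one>\<^bsub>T\<^esub>"
      and right: "(e i \<bullet> e j) [^]\<^bsub>T\<^esub> int (n j) = \<one>\<^bsub>T\<^esub>" for i j
    proof -
      interpret l: group_hom G T "\<lambda>h. h \<bullet> e j"
        by unfold_locales (simp add: tensor_hom_left)
      interpret r: group_hom G T "\<lambda>h. e i \<bullet> h"
        by unfold_locales (simp add: tensor_hom_right)
      show "(e i \<bullet> e j) [^]\<^bsub>T\<^esub> int (n i) = \<one>\<^bsub>T\<^esub>"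
        using l.hom_int_pow[of "e i" "int (n i)"] by (simp add: e_pow)
      show "(e i \<bullet> e j) [^]\<^bsub>T\<^esub> int (n j) = \<one>\<^bsub>T\<^esub>"
        using r.hom_int_pow[of "e j" "int (n j)"] by (simp add: e_pow)
    qed
    show "s p [^]\<^bsub>T\<^esub> c p = \<one>\<^bsub>T\<^esub>"
    proof (rule T.int_pow_gcd_eq_one)
      show "int (gcd (n i) (n j)) dvd c p" using c \<open>p \<in> P\<close> p by auto
    qed (simp_all add: p s left right T.int_pow_distrib)
  qed
  \<comment> \<open>Independence: for each pair a homomorphism to the integers modulo
    \<open>m\<close> is built that sends the basis element at \<open>(k, l)\<close> to 1 and all
    others to 0.\<close>
  have divides: "int (gcd (n k) (n l)) dvd c (k, l)" if c: "\<Theta> c = \<one>\<^bsub>T\<^esub>" and kl: "(k, l) \<in> P" for c k l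
  proof -
    define m where "m = gcd (n k) (n l)"
    define cf where "cf g = (SOME a. \<theta> a = g)" for g
    have cf: "\<theta> (cf g) = g" if "g \<in> carrier G" for g
    proof -
      obtain a where "g = \<theta> a" using cyclic_coordinates_surj[OF \<theta> \<open>g \<in> carrier G\<close>] .
      then show ?thesis unfolding cf_def by (intro someI[of "\<lambda>a. \<theta> a = g" a]) simp
    qed
    \<comment> \<open>Since \<open>m\<close> divides \<open>n k\<close> and \<open>n l\<close>,
      these two coordinates are well defined modulo \<open>m\<close>, whatever \<open>cf\<close>
      chooses.\<close>
    have mod: "a i mod int m = b i mod int m" if "\<theta> a = \<theta> b" "i \<in> {k, l}" for a b i
    proof -
      have "a i mod int (n i) = b i mod int (n i)"
        using that kl by (auto simp: cyclic_coordinates_eq_iff[OF G.group_axioms \<theta>] P)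
      moreover have "int m dvd int (n i)" using that by (auto simp: m_def)
      ultimately show ?thesis by (metis mod_mod_cancel)
    qed
    have cf_mult: "cf (g \<otimes>\<^bsub>G\<^esub> h) i mod int m = (cf g i + cf h i) mod int m"
      if "g \<in> carrier G" "h \<in> carrier G" "i \<in> {k, l}" for g h i
      using that by (intro mod) (simp_all add: cf cyclic_coordinates_add[OF \<theta>])
    have cf_e: "cf (e j) i mod int m = (if i = j then 1 else 0) mod int m" if "i \<in> {k, l}" for i j
    proof -
      have "\<theta> (cf (e j)) = e j" by (simp add: cf)
      also have "e j = \<theta> ((\<lambda>_. 0)(j := 1))" by (simp add: e)
      finally show ?thesis using mod[of "cf (e j)" "(\<lambda>_. 0)(j := 1)" i] that by simp
    qed
    have "\<exists>\<phi>\<in>hom T (cyc m). \<forall>g\<in>carrier G. \<forall>h\<in>carrier G. \<phi> (g \<bullet> h) = (cf g k * cf h l) mod int m"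
    proof (rule tensor_square_universal)
      show "(cf g k * cf h l) mod int m \<in> carrier (cyc m)" for g h
        by (simp add: carrier_integer_mod_group)
      show "(cf (g \<otimes>\<^bsub>G\<^esub> g') k * cf h l) mod int m =
          ((cf g k * cf h l) mod int m) \<otimes>\<^bsub>cyc m\<^esub> ((cf g' k * cf h l) mod int m)"
        if "g \<in> carrier G" "g' \<in> carrier G" for g g' h
        using cf_mult[OF that, of k]
        by (simp add: mod_add_eq flip: distrib_right) (metis mod_mult_left_eq)
      show "(cf g k * cf (h \<otimes>\<^bsub>G\<^esub> h') l) mod int m =
          ((cf g k * cf h l) mod int m) \<otimes>\<^bsub>cyc m\<^esub> ((cf g k * cf h' l) mod int m)"
        if "h \<in> carrier G" "h' \<in> carrier G" for g h h'
        using cf_mult[OF that, of l]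
        by (simp add: mod_add_eq flip: distrib_left) (metis mod_mult_right_eq)
    qed simp
    then obtain \<phi> where \<phi>: "\<phi> \<in> hom T (cyc m)" and \<phi>_tensor:
      "\<And>g h. g \<in> carrier G \<Longrightarrow> h \<in> carrier G \<Longrightarrow> \<phi> (g \<bullet> h) = (cf g k * cf h l) mod int m"
      by blast
    \<comment> \<open>The reduction modulo \<open>m\<close> matters for \<open>m = 1\<close>, where
      1 becomes 0.\<close>
    have \<phi>_e: "\<phi> (e i \<bullet> e j) = (if (k, l) = (i, j) then 1 else 0) mod int m" for i j
    proof -
      have "\<phi> (e i \<bullet> e j) = ((cf (e i) k mod int m) * (cf (e j) l mod int m)) mod int m"
        by (simp add: \<phi>_tensor mod_mult_eq)
      then show ?thesis by (simp add: cf_e mod_mult_eq)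
    qed
    have \<phi>_s: "\<phi> (s (i, j)) = (if (k, l) = (i, j) then 1 else 0) mod int m" if "i \<le> j" for i j
    proof (cases "i = j")
      case True
      then show ?thesis using \<phi>_e[of i j] by (simp add: s)
    next
      case False
      \<comment> \<open>As \<open>k \<le> l\<close> and \<open>i < j\<close>, at most the first of
        the two tensors in \<open>s (i, j)\<close> contributes.\<close>
      moreover have "(k, l) \<noteq> (j, i)" using kl that False by (auto simp: P)
      ultimately show ?thesis
        by (auto simp: s hom_mult[OF \<phi>] \<phi>_e)
    qed
    have \<phi>_pow: "\<phi> (s p [^]\<^bsub>T\<^esub> c p) = (if (k, l) = p then c p mod int m else 0)" if "p \<in> P" for p
    proof (cases p)
      case (Pair i j)
      then show ?thesis
        using that by (simp add: P hom_int_pow[OF \<phi>] int_pow_integer_mod_group \<phi>_s mod_mult_right_eq)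
    qed
    \<comment> \<open>Only the factor at \<open>(k, l)\<close> survives, so \<open>\<phi>\<close>
      reads off the coefficient there modulo \<open>m\<close>.\<close>
    have "\<phi> (\<Theta> c) = finprod (cyc m) (\<phi> \<circ> (\<lambda>p. s p [^]\<^bsub>T\<^esub> c p)) P"
      unfolding \<Theta>_def by (rule finprod_hom[OF \<phi>]) (simp_all add: T.comm_group_axioms)
    also have "\<dots> = (\<phi> \<circ> (\<lambda>p. s p [^]\<^bsub>T\<^esub> c p)) (k, l)"
      using kl \<open>finite P\<close>
      by (intro comm_monoid.finprod_eq_single comm_group.axioms(1)[OF abelian_integer_mod_group])
        (simp_all add: \<phi>_pow carrier_integer_mod_group)
    also have "\<dots> = c (k, l) mod int m" using kl by (simp add: \<phi>_pow)
    finally have "c (k, l) mod int m = 0"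
      using c hom_one[OF \<phi>] by simp
    then show ?thesis by (simp add: m_def mod_eq_0_iff_dvd)
  qed
  have "\<Theta> c = \<one>\<^bsub>T\<^esub> \<longleftrightarrow> (\<forall>p\<in>P. int ((\<lambda>(i, j). gcd (n i) (n j)) p) dvd c p)" for c
  proof
    assume "\<Theta> c = \<one>\<^bsub>T\<^esub>"
    then show "\<forall>p\<in>P. int ((\<lambda>(i, j). gcd (n i) (n j)) p) dvd c p"
      using divides by (intro ballI) (clarsimp split: prod.splits)
  next
    assume "\<forall>p\<in>P. int ((\<lambda>(i, j). gcd (n i) (n j)) p) dvd c p"
    then show "\<Theta> c = \<one>\<^bsub>T\<^esub>"
      by (rule vanishes)
  qed
  moreover have "range \<Theta> = carrier (nabla G)"
    using N_sub sub_N unfolding N_def by (rule equalityI[rotated])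
  \<comment> \<open>The subgroup inherits the operations of \<open>T\<close>, so the facts proved in
    \<open>T\<close> carry over.\<close>
  moreover have "\<one>\<^bsub>nabla G\<^esub> = \<one>\<^bsub>T\<^esub>" "monoid.mult (nabla G) = monoid.mult T"
    by (simp_all add: nabla_def)
  ultimately show ?thesis
    unfolding cyclic_coordinates_def \<Theta>_def[symmetric] by (simp only: add simp_thms)
qed

end

section \<open>Invariants of the diagonal subgroup\<close>

text \<open>Positions in \<open>ps\<close> replace the indices; distinctness makes the position of
  an index unique.\<close>

lemma abelian_invariants_of_coordinates:
  assumes "group G" and \<theta>: "cyclic_coordinates G (set ps) n \<theta>" and "distinct ps"
  shows "abelian_invariants G (map n ps)"
proof (rule abelian_invariantsI)
  define \<eta> where "\<eta> c = \<theta> (\<lambda>p. c (inv_into {..<length ps} ((!) ps) p))" for c :: "nat \<Rightarrow> int"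
  have bij: "bij_betw ((!) ps) {..<length ps} (set ps)"
    using bij_betw_nth[OF \<open>distinct ps\<close>] by blast
  have inv: "inv_into {..<length ps} ((!) ps) (ps ! i) = i" if "i < length ps" for i
    using bij_betw_inv_into_left[OF bij] that by simp
  have "\<theta> a \<in> range \<eta>" for a
  proof (rule range_eqI)
    show "\<theta> a = \<eta> (\<lambda>i. a (ps ! i))"
      unfolding \<eta>_def cyclic_coordinates_eq_iff[OF \<open>group G\<close> \<theta>]
      using bij_betw_inv_into_right[OF bij] by simp
  qed
  then have "range \<eta> = carrier G"
    using cyclic_coordinates_closed[OF \<theta>]
    by (auto simp: \<eta>_def elim: cyclic_coordinates_surj[OF \<theta>])
  moreover have "\<eta> c = \<one>\<^bsub>G\<^esub> \<longleftrightarrow> (\<forall>i\<in>{..<length (map n ps)}. int (map n ps ! i) dvd c i)" for c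
    by (simp add: \<eta>_def cyclic_coordinates_one_iff[OF \<theta>] inv
        all_set_conv_all_nth[of ps "\<lambda>p. int (n p) dvd c (inv_into {..<length ps} ((!) ps) p)"] Ball_def[of "{..<_}"])
  ultimately show "cyclic_coordinates G {..<length (map n ps)} ((!) (map n ps)) \<eta>"
    unfolding cyclic_coordinates_def by (simp add: \<eta>_def cyclic_coordinates_add[OF \<theta>])
qed fact

text \<open>These are the orders of the basis of the diagonal subgroup, row by row; the leading
  \<open>n\<close> is the diagonal entry, the gcd of \<open>n\<close> with itself.\<close>

fun gcd_pairs :: "nat list \<Rightarrow> nat list" where
  "gcd_pairs [] = []"
| "gcd_pairs (n # ns) = n # map (gcd n) ns @ gcd_pairs ns"

lemma map_upt_Suc_Suc: "map f [Suc i..<Suc k] = map (\<lambda>j. f (Suc j)) [i..<k]"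
  by (simp add: map_Suc_upt[symmetric] comp_def del: upt_Suc)

lemma gcd_pairs_eq:
  "gcd_pairs ns = concat (map (\<lambda>i. map (\<lambda>j. gcd (ns ! i) (ns ! j)) [i..<length ns]) [0..<length ns])"
proof (induction ns)
  case (Cons n ns)
  have "map (\<lambda>j. gcd n (ns ! j)) [0..<length ns] = map (gcd n) ns"
    by (rule nth_equalityI) auto
  then show ?case
    by (simp add: upt_conv_Cons map_upt_Suc_Suc Cons.IH del: upt_Suc)
qed simp

theorem abelian_invariants_nabla:
  assumes "comm_group G" "abelian_invariants G ns"
  shows "abelian_invariants (nabla G) (gcd_pairs ns)"
proof -
  define r where "r = length ns"
  \<comment> \<open>The triangle of index pairs is listed by rows, in the order of
    \<open>gcd_pairs_eq\<close>.\<close>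
  define ps where "ps = concat (map (\<lambda>i. map (Pair i) [i..<r]) [0..<r])"
  obtain \<theta> where \<theta>: "cyclic_coordinates G {..<r} ((!) ns) \<theta>"
    using assms(2) unfolding abelian_invariants_def r_def by blast
  have "set ps = {(i, j). i \<in> {..<r} \<and> j \<in> {..<r} \<and> i \<le> j}"
    by (auto simp: ps_def image_iff)
  moreover have "distinct ps"
    unfolding ps_def
  proof (rule distinct_concat)
    \<comment> \<open>Row \<open>i\<close> is nonempty for \<open>i < r\<close>: it contains
      \<open>(i, i)\<close>, which reveals its index.\<close>
    have "i = k" if "i < r" "map (Pair i) [i..<r] = map (Pair k) [k..<r]" for i k
    proof -
      have "(i, i) \<in> set (map (Pair i) [i..<r])" using that(1) by simp
      then show "i = k" unfolding that(2) by auto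
    qed
    then show "distinct (map (\<lambda>i. map (Pair i) [i..<r]) [0..<r])"
      by (auto simp: distinct_map intro!: inj_onI)
  qed (auto simp: distinct_map inj_on_def)
  moreover have "group (nabla G)"
    unfolding nabla_def tensor_square_def
    by (intro group.group_subgroup_generated group_presented_group)
  ultimately have "abelian_invariants (nabla G) (map (\<lambda>(i, j). gcd (ns ! i) (ns ! j)) ps)"
    using nabla_cyclic_coordinates[OF assms(1) finite_lessThan \<theta> HOL.refl HOL.refl HOL.refl]
    by (intro abelian_invariants_of_coordinates) simp_all
  moreover have "map (\<lambda>(i, j). gcd (ns ! i) (ns ! j)) ps = gcd_pairs ns"
    by (simp add: gcd_pairs_eq ps_def r_def map_concat comp_def)
  ultimately show ?thesis by simp
qed

text \<open>A multiset of invariants determines the group up to isomorphism, so each case becomes a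
  comparison of two explicit multisets.\<close>

lemma nabla_iso:
  assumes "comm_group G" "abelian_invariants H ns" "abelian_invariants K ms"
    and "mset (gcd_pairs ns) = mset ms"
  shows "G \<cong> H \<longrightarrow> nabla G \<cong> K"
proof
  assume "G \<cong> H"
  then have "abelian_invariants G ns"
    using abelian_invariants_iso[OF comm_group.axioms(2)[OF assms(1)] _ assms(2)] by simp
  then show "nabla G \<cong> K"
    using abelian_invariants_imp_iso[OF abelian_invariants_nabla] assms by blast
qed

theorem lemma2p3:
  fixes p :: nat and G :: "('a, 'b) monoid_scheme"
  assumes "prime p" and "p > 3"
    and "comm_group G" and "order G dvd p ^ 5"
  shows
    "(G \<cong> cyc (p^5) \<longrightarrow>
        nabla G \<cong> cyc (p^5)) \<and>
     (G \<cong> cyc (p^3) \<times>\<times> cyc (p^2) \<longrightarrow>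
        nabla G \<cong> cyc (p^3) \<times>\<times> copies (cyc (p^2)) 2) \<and>
     (G \<cong> cyc (p^4) \<times>\<times> cyc p \<longrightarrow>
        nabla G \<cong> cyc (p^4) \<times>\<times> copies (cyc p) 2) \<and>
     (G \<cong> cyc (p^2) \<times>\<times> cyc (p^2) \<times>\<times> cyc p \<longrightarrow>
        nabla G \<cong> copies (cyc (p^2)) 3 \<times>\<times> copies (cyc p) 3) \<and>
     (G \<cong> cyc (p^3) \<times>\<times> cyc p \<times>\<times> cyc p \<longrightarrow>
        nabla G \<cong> cyc (p^3) \<times>\<times> copies (cyc p) 5) \<and>
     (G \<cong> cyc (p^2) \<times>\<times> cyc p \<times>\<times> cyc p \<times>\<times> cyc p \<longrightarrow>
        nabla G \<cong> cyc (p^2) \<times>\<times> copies (cyc p) 9) \<and>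
     (G \<cong> copies (cyc p) 5 \<longrightarrow>
        nabla G \<cong> copies (cyc p) 15)"
proof -
  note invariants = abelian_invariants_cyc abelian_invariants_copies_cyc abelian_invariants_DirProd
  \<comment> \<open>Apart from gcds of equal numbers, only these occur among the factor orders of
    the seven groups.\<close>
  have gcd: "gcd (p ^ 3) (p\<^sup>2) = p\<^sup>2" "gcd (p ^ numeral k) p = p" for k
    by (simp_all add: gcd_nat.absorb2 le_imp_power_dvd)
  \<comment> \<open>Repeated invariants are unfolded into explicit lists, so that
    \<open>gcd_pairs\<close> evaluates and the multisets can be compared entry by entry.\<close>
  have numeral_replicate: "replicate (numeral k) x = x # replicate (pred_numeral k) x" for k and x :: nat
    by (simp add: numeral_eq_Suc)
  show ?thesis
    by (intro conjI; (rule nabla_iso[OF \<open>comm_group G\<close>], (rule invariants)+, simp add: gcd numeral_replicate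
        del: mset_replicate))
qed

end
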